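(* Any sequent $\Gamma\vdash\Lambda$ derivable in $LJ^+$ is valid.
   Context: Formulas are first-order formulas of a language $L$ without function symbols and without object constants, built from propositional symbols (relation symbols of arity $0$), predicate symbols (relation symbols of arity at least $1$), the logical constants $\top,\bot$, the connectives $\&,\lor,\neg,\supset$ and the quantifiers $\forall,\exists$; quantified formulas $\forall x\,F(x)$, $\exists x\,F(x)$ are formed only from $F(x)$ in which $x$ occurs free. $\top,\bot$ are not counted as propositional or predicate symbols. A formula is propositional if it contains only propositional symbols (no predicate symbols). A sequent is $\Gamma\vdash\Lambda$ with $\Gamma$ a finite, possibly empty sequence of formulas and $\Lambda$ either a single formula or empty. The calculus $LJ$ (Gentzen's intuitionistic sequent calculus) has axioms $A\vdash A$ (any formula $A$), $\vdash\top$, $\bot\vdash$, and the following rules (premises / conclusion). Thinning: $\Gamma\vdash\Lambda\,/\,A,\Gamma\vdash\Lambda$; $\Gamma\vdash\,/\,\Gamma\vdash A$. Contraction: $A,A,\Gamma\vdash\Lambda\,/\,A,\Gamma\vdash\Lambda$. Exchange: $\Pi,A,B,\Gamma\vdash\Lambda\,/\,\Pi,B,A,\Gamma\vdash\Lambda$. Cut: $\Gamma\vdash C$ and $C,\Pi\vdash\Lambda\,/\,\Gamma,\Pi\vdash\Lambda$. $\&$: $\Gamma\vdash A$ and $\Gamma\vdash B\,/\,\Gamma\vdash A\&B$; $A,\Gamma\vdash\Lambda\,/\,A\&B,\Gamma\vdash\Lambda$; $B,\Gamma\vdash\Lambda\,/\,A\&B,\Gamma\vdash\Lambda$. $\lor$: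 $A,\Gamma\vdash\Lambda$ and $B,\Gamma\vdash\Lambda\,/\,A\lor B,\Gamma\vdash\Lambda$; $\Gamma\vdash A\,/\,\Gamma\vdash A\lor B$; $\Gamma\vdash B\,/\,\Gamma\vdash A\lor B$. $\neg$: $A,\Gamma\vdash\,/\,\Gamma\vdash\neg A$; $\Gamma\vdash A\,/\,\neg A,\Gamma\vdash$. $\supset$: $A,\Gamma\vdash B\,/\,\Gamma\vdash A\supset B$; $\Gamma\vdash A$ and $B,\Pi\vdash\Lambda\,/\,A\supset B,\Gamma,\Pi\vdash\Lambda$. $\forall$: $\Gamma\vdash F(a)\,/\,\Gamma\vdash\forall x\,F(x)$; $F(a),\Gamma\vdash\Lambda\,/\,\forall x\,F(x),\Gamma\vdash\Lambda$. $\exists$: $\Gamma\vdash F(a)\,/\,\Gamma\vdash\exists x\,F(x)$; $F(a),\Gamma\vdash\Lambda\,/\,\exists x\,F(x),\Gamma\vdash\Lambda$. Here $a$ is a variable and $F(a)$ is the result of (capture-free) substitution of $a$ for $x$ in $F(x)$; in the $\forall$-succedent and $\exists$-antecedent rules $a$ (the eigenvariable) must not occur in the conclusion. $LJ^+$ is $LJ$ extended with the neutralization rule: $N,\Gamma\vdash\Lambda$ and $\neg N,\Gamma\vdash\Lambda\,/\,\Gamma\vdash\Lambda$, where $N$ must be a propositional formula. A Kripke structure $K$ consists of a partially ordered set (also denoted $K$) of nodes, a function $D$ assigning to each node $k$ a nonempty domain $D(k)$ with $D(k)\subseteq D(k')$ whenever $k\le k'$, and a valuation $T$ assigning to each node $k$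 a set $T(k)$ of atomic expressions of $L$ over $D(k)$ (expressions $P(d_1,\dots,d_n)$, $n\ge 0$, $d_i\in D(k)$) with $T(k)\subseteq T(k')$ whenever $k\le k'$. Forcing: $k$ forces an atomic expression $P(d_1,\dots,d_n)$ iff it is in $T(k)$; $k$ forces $A\&B$ iff $k$ forces $A$ and $k$ forces $B$; $k$ forces $A\lor B$ iff $k$ forces $A$ or $k$ forces $B$; $k$ forces $A\supset B$ iff for every $k'\ge k$, if $k'$ forces $A$ then $k'$ forces $B$; $k$ forces $\neg A$ iff no $k'\ge k$ forces $A$; $k$ forces $\forall x\,A(x)$ iff for every $k'\ge k$ and every $d\in D(k')$, $k'$ forces $A(d)$; $k$ forces $\exists x\,A(x)$ iff for some $d\in D(k)$, $k$ forces $A(d)$; $\top$ is forced by every node and $\bot$ by none. A Kripke structure is constrained if for all $k\le k'$ and every propositional symbol $Q$, either both $T(k)$ and $T(k')$ contain $Q$ or neither does. A sequent $\Gamma\vdash\Lambda$ is valid if for every node $k$ of every constrained Kripke structure (and every assignment of elements of $D(k)$ to the free variables of the sequent), either some formula $A$ of $\Gamma$ is not forced by $k$, or $\Lambda$ is nonempty and $k$ forces $\Lambda$. *)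

theory Defs
  imports Main
begin

text \<open>
  A language maps each of its relation symbols to the arity of the symbol; symbols of arity 0 are
  the propositional symbols. Individual variables are natural numbers.
\<close>

type_synonym 'p lang = "'p \<rightharpoonup> nat"

datatype 'p fm =
    Top
  | Bot
  | Atom 'p "nat list"
  | Conj "'p fm" "'p fm"
  | Disj "'p fm" "'p fm"
  | Neg "'p fm"
  | Imp "'p fm" "'p fm"
  | All nat "'p fm"
  | Ex nat "'p fm"

primrec FV :: "'p fm \<Rightarrow> nat set" where
  "FV Top = {}"
| "FV Bot = {}"
| "FV (Atom P xs) = set xs"
| "FV (Conj A B) = FV A \<union> FV B"
| "FV (Disj A B) = FV A \<union> FV B"
| "FV (Neg A) = FV A"
| "FV (Imp A B) = FV A \<union> FV B"
| "FV (All x F) = FV F - {x}"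
| "FV (Ex x F) = FV F - {x}"

definition FV_seq :: "'p fm list \<Rightarrow> 'p fm option \<Rightarrow> nat set" where
  "FV_seq \<Gamma> \<Lambda> = (\<Union>A \<in> set \<Gamma> \<union> set_option \<Lambda>. FV A)"

text \<open>Vacuous quantification is excluded.\<close>

primrec formula :: "'p lang \<Rightarrow> 'p fm \<Rightarrow> bool" where
  "formula L Top \<longleftrightarrow> True"
| "formula L Bot \<longleftrightarrow> True"
| "formula L (Atom P xs) \<longleftrightarrow> L P = Some (length xs)"
| "formula L (Conj A B) \<longleftrightarrow> formula L A \<and> formula L B"
| "formula L (Disj A B) \<longleftrightarrow> formula L A \<and> formula L B"
| "formula L (Neg A) \<longleftrightarrow> formula L A"
| "formula L (Imp A B) \<longleftrightarrow> formula L A \<and> formula L B"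
| "formula L (All x F) \<longleftrightarrow> formula L F \<and> x \<in> FV F"
| "formula L (Ex x F) \<longleftrightarrow> formula L F \<and> x \<in> FV F"

primrec symbols :: "'p fm \<Rightarrow> 'p set" where
  "symbols Top = {}"
| "symbols Bot = {}"
| "symbols (Atom P xs) = {P}"
| "symbols (Conj A B) = symbols A \<union> symbols B"
| "symbols (Disj A B) = symbols A \<union> symbols B"
| "symbols (Neg A) = symbols A"
| "symbols (Imp A B) = symbols A \<union> symbols B"
| "symbols (All x F) = symbols F"
| "symbols (Ex x F) = symbols F"

definition propositional :: "'p lang \<Rightarrow> 'p fm \<Rightarrow> bool" where
  "propositional L A \<longleftrightarrow> formula L A \<and> (\<forall>P \<in> symbols A. L P = Some 0)"

text \<open>
  \<open>subst F x a\<close> replaces the free occurrences of \<open>x\<close> by \<open>a\<close> without renaming bound variables;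
  it is capture-free exactly when \<open>free_for a x F\<close> holds.
\<close>

primrec subst :: "'p fm \<Rightarrow> nat \<Rightarrow> nat \<Rightarrow> 'p fm" where
  "subst Top x a = Top"
| "subst Bot x a = Bot"
| "subst (Atom P ys) x a = Atom P (map (\<lambda>y. if y = x then a else y) ys)"
| "subst (Conj A B) x a = Conj (subst A x a) (subst B x a)"
| "subst (Disj A B) x a = Disj (subst A x a) (subst B x a)"
| "subst (Neg A) x a = Neg (subst A x a)"
| "subst (Imp A B) x a = Imp (subst A x a) (subst B x a)"
| "subst (All y F) x a = All y (if y = x then F else subst F x a)"
| "subst (Ex y F) x a = Ex y (if y = x then F else subst F x a)"

primrec free_for :: "nat \<Rightarrow> nat \<Rightarrow> 'p fm \<Rightarrow> bool" where
  "free_for a x Top \<longleftrightarrow> True"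
| "free_for a x Bot \<longleftrightarrow> True"
| "free_for a x (Atom P ys) \<longleftrightarrow> True"
| "free_for a x (Conj A B) \<longleftrightarrow> free_for a x A \<and> free_for a x B"
| "free_for a x (Disj A B) \<longleftrightarrow> free_for a x A \<and> free_for a x B"
| "free_for a x (Neg A) \<longleftrightarrow> free_for a x A"
| "free_for a x (Imp A B) \<longleftrightarrow> free_for a x A \<and> free_for a x B"
| "free_for a x (All y F) \<longleftrightarrow> x \<notin> FV (All y F) \<or> y \<noteq> a \<and> free_for a x F"
| "free_for a x (Ex y F) \<longleftrightarrow> x \<notin> FV (Ex y F) \<or> y \<noteq> a \<and> free_for a x F"

text \<open>
  \<open>LJ_plus L \<Gamma> \<Lambda>\<close>: the sequent with antecedent \<open>\<Gamma>\<close> and succedent \<open>\<Lambda>\<close> (\<open>None\<close> for an empty one)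
  is derivable. The premises of the form \<open>formula L A\<close> restrict derivations to formulas of \<open>L\<close>.
  Since a variable may occur both free and bound, the eigenvariable condition is read as
  ``not free in the conclusion''; this admits every derivation in which the eigenvariable does not
  occur in the conclusion at all.
\<close>

inductive LJ_plus :: "'p lang \<Rightarrow> 'p fm list \<Rightarrow> 'p fm option \<Rightarrow> bool" for L :: "'p lang" where
  Ax: "formula L A \<Longrightarrow> LJ_plus L [A] (Some A)"
| TopAx: "LJ_plus L [] (Some Top)"
| BotAx: "LJ_plus L [Bot] None"
| ThinL: "LJ_plus L \<Gamma> \<Lambda> \<Longrightarrow> formula L A \<Longrightarrow> LJ_plus L (A # \<Gamma>) \<Lambda>"
| ThinR: "LJ_plus L \<Gamma> None \<Longrightarrow> formula L A \<Longrightarrow> LJ_plus L \<Gamma> (Some A)"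
| Contr: "LJ_plus L (A # A # \<Gamma>) \<Lambda> \<Longrightarrow> LJ_plus L (A # \<Gamma>) \<Lambda>"
| Exch: "LJ_plus L (\<Pi> @ A # B # \<Gamma>) \<Lambda> \<Longrightarrow> LJ_plus L (\<Pi> @ B # A # \<Gamma>) \<Lambda>"
| Cut: "LJ_plus L \<Gamma> (Some C) \<Longrightarrow> LJ_plus L (C # \<Pi>) \<Lambda> \<Longrightarrow> LJ_plus L (\<Gamma> @ \<Pi>) \<Lambda>"
| ConjR: "LJ_plus L \<Gamma> (Some A) \<Longrightarrow> LJ_plus L \<Gamma> (Some B) \<Longrightarrow> LJ_plus L \<Gamma> (Some (Conj A B))"
| ConjL1: "LJ_plus L (A # \<Gamma>) \<Lambda> \<Longrightarrow> formula L B \<Longrightarrow> LJ_plus L (Conj A B # \<Gamma>) \<Lambda>"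
| ConjL2: "LJ_plus L (B # \<Gamma>) \<Lambda> \<Longrightarrow> formula L A \<Longrightarrow> LJ_plus L (Conj A B # \<Gamma>) \<Lambda>"
| DisjL: "LJ_plus L (A # \<Gamma>) \<Lambda> \<Longrightarrow> LJ_plus L (B # \<Gamma>) \<Lambda> \<Longrightarrow> LJ_plus L (Disj A B # \<Gamma>) \<Lambda>"
| DisjR1: "LJ_plus L \<Gamma> (Some A) \<Longrightarrow> formula L B \<Longrightarrow> LJ_plus L \<Gamma> (Some (Disj A B))"
| DisjR2: "LJ_plus L \<Gamma> (Some B) \<Longrightarrow> formula L A \<Longrightarrow> LJ_plus L \<Gamma> (Some (Disj A B))"
| NegR: "LJ_plus L (A # \<Gamma>) None \<Longrightarrow> LJ_plus L \<Gamma> (Some (Neg A))"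
| NegL: "LJ_plus L \<Gamma> (Some A) \<Longrightarrow> LJ_plus L (Neg A # \<Gamma>) None"
| ImpR: "LJ_plus L (A # \<Gamma>) (Some B) \<Longrightarrow> LJ_plus L \<Gamma> (Some (Imp A B))"
| ImpL: "LJ_plus L \<Gamma> (Some A) \<Longrightarrow> LJ_plus L (B # \<Pi>) \<Lambda> \<Longrightarrow> LJ_plus L (Imp A B # \<Gamma> @ \<Pi>) \<Lambda>"
| AllR: "LJ_plus L \<Gamma> (Some (subst F x a)) \<Longrightarrow> formula L (All x F) \<Longrightarrow> free_for a x F \<Longrightarrow>
    a \<notin> FV_seq \<Gamma> (Some (All x F)) \<Longrightarrow> LJ_plus L \<Gamma> (Some (All x F))"
| AllL: "LJ_plus L (subst F x a # \<Gamma>) \<Lambda> \<Longrightarrow> formula L (All x F) \<Longrightarrow> free_for a x F \<Longrightarrow>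
    LJ_plus L (All x F # \<Gamma>) \<Lambda>"
| ExR: "LJ_plus L \<Gamma> (Some (subst F x a)) \<Longrightarrow> formula L (Ex x F) \<Longrightarrow> free_for a x F \<Longrightarrow>
    LJ_plus L \<Gamma> (Some (Ex x F))"
| ExL: "LJ_plus L (subst F x a # \<Gamma>) \<Lambda> \<Longrightarrow> formula L (Ex x F) \<Longrightarrow> free_for a x F \<Longrightarrow>
    a \<notin> FV_seq (Ex x F # \<Gamma>) \<Lambda> \<Longrightarrow> LJ_plus L (Ex x F # \<Gamma>) \<Lambda>"
| Neutralization: "LJ_plus L (N # \<Gamma>) \<Lambda> \<Longrightarrow> LJ_plus L (Neg N # \<Gamma>) \<Lambda> \<Longrightarrow> propositional L N \<Longrightarrow>
    LJ_plus L \<Gamma> \<Lambda>"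

text \<open>\<open>Val K k\<close> is the set of atomic expressions \<open>P(d\<^sub>1,\<dots>,d\<^sub>n)\<close>, coded as pairs \<open>(P, [d\<^sub>1,\<dots>,d\<^sub>n])\<close>.\<close>

record ('p, 'n, 'd) kripke =
  Nodes :: "'n set"
  Le :: "('n \<times> 'n) set"
  Dom :: "'n \<Rightarrow> 'd set"
  Val :: "'n \<Rightarrow> ('p \<times> 'd list) set"

definition kripke_structure :: "'p lang \<Rightarrow> ('p, 'n, 'd) kripke \<Rightarrow> bool" where
  "kripke_structure L K \<longleftrightarrow>
     partial_order_on (Nodes K) (Le K) \<and>
     (\<forall>k \<in> Nodes K. Dom K k \<noteq> {}) \<and>
     (\<forall>k \<in> Nodes K. \<forall>(P, ds) \<in> Val K k. L P = Some (length ds) \<and> set ds \<subseteq> Dom K k) \<and>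
     (\<forall>(k, k') \<in> Le K. Dom K k \<subseteq> Dom K k' \<and> Val K k \<subseteq> Val K k')"

definition constrained :: "'p lang \<Rightarrow> ('p, 'n, 'd) kripke \<Rightarrow> bool" where
  "constrained L K \<longleftrightarrow>
     (\<forall>(k, k') \<in> Le K. \<forall>Q. L Q = Some 0 \<longrightarrow> ((Q, []) \<in> Val K k \<longleftrightarrow> (Q, []) \<in> Val K k'))"

text \<open>The assignment \<open>e\<close> supplies the elements substituted for the free variables.\<close>

primrec forces :: "('p, 'n, 'd) kripke \<Rightarrow> 'n \<Rightarrow> (nat \<Rightarrow> 'd) \<Rightarrow> 'p fm \<Rightarrow> bool" where
  "forces K k e Top \<longleftrightarrow> True"
| "forces K k e Bot \<longleftrightarrow> False"
| "forces K k e (Atom P xs) \<longleftrightarrow> (P, map e xs) \<in> Val K k"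
| "forces K k e (Conj A B) \<longleftrightarrow> forces K k e A \<and> forces K k e B"
| "forces K k e (Disj A B) \<longleftrightarrow> forces K k e A \<or> forces K k e B"
| "forces K k e (Neg A) \<longleftrightarrow> (\<forall>k'. (k, k') \<in> Le K \<longrightarrow> \<not> forces K k' e A)"
| "forces K k e (Imp A B) \<longleftrightarrow> (\<forall>k'. (k, k') \<in> Le K \<longrightarrow> forces K k' e A \<longrightarrow> forces K k' e B)"
| "forces K k e (All x F) \<longleftrightarrow>
     (\<forall>k'. (k, k') \<in> Le K \<longrightarrow> (\<forall>d \<in> Dom K k'. forces K k' (e(x := d)) F))"
| "forces K k e (Ex x F) \<longleftrightarrow> (\<exists>d \<in> Dom K k. forces K k (e(x := d)) F)"

text \<open>
  Validity over all constrained structures whose nodes have type \<open>'n\<close> and whose domain elements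
  have type \<open>'d\<close>; the first argument only names these two types.
\<close>

definition valid :: "('n \<times> 'd) itself \<Rightarrow> 'p lang \<Rightarrow> 'p fm list \<Rightarrow> 'p fm option \<Rightarrow> bool" where
  "valid (_ :: ('n \<times> 'd) itself) L \<Gamma> \<Lambda> \<longleftrightarrow>
     (\<forall>(K :: ('p, 'n, 'd) kripke) k e.
        kripke_structure L K \<longrightarrow> constrained L K \<longrightarrow> k \<in> Nodes K \<longrightarrow>
        (\<forall>x \<in> FV_seq \<Gamma> \<Lambda>. e x \<in> Dom K k) \<longrightarrow>
        (\<exists>A \<in> set \<Gamma>. \<not> forces K k e A) \<or> (\<exists>B. \<Lambda> = Some B \<and> forces K k e B))"

end

theory Submission
  imports Defs
begin

text \<open>
  Soundness is by induction on the derivation, and two points go beyond reading off the forcing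
  clauses.

  The neutralization rule is sound because a propositional formula has no free variables, hence no
  (non-vacuous) quantifiers, so that in a constrained structure its forcing is the same at \<open>k\<close>
  and at every \<open>k' \<ge> k\<close> (\<open>propositional_stable\<close>). If \<open>k\<close> does not force \<open>N\<close>, then no later node does,
  that is, \<open>k\<close> forces \<open>\<not> N\<close>; one of the two premises therefore applies.

  Validity only asks that the variables free in the sequent get values in the domain of the node. In
  this form the induction breaks down at those rules, such as Cut, whose premises have free variables
  that are missing in the conclusion. The induction is therefore carried out for assignments that
  send every variable into the domain (\<open>soundness_total\<close>). Since domains are nonempty and
  forcing depends only on the free variables, an arbitrary assignment can be replaced by such a total
  one.
\<close>

section \<open>Forcing, free variables and substitution\<close>

lemma forces_cong:
  assumes "\<And>x. x \<in> FV A \<Longrightarrow> e x = e' x"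
  shows "forces K k e A \<longleftrightarrow> forces K k e' A"
  using assms
proof (induction A arbitrary: k e e')
  case (Atom P xs)
  then have "map e xs = map e' xs" by simp
  then show ?case by (simp only: forces.simps)
next
  case (Conj A B)
  have "forces K k e A = forces K k e' A" "forces K k e B = forces K k e' B"
    by (auto intro!: Conj.IH Conj.prems)
  then show ?case by simp
next
  case (Disj A B)
  have "forces K k e A = forces K k e' A" "forces K k e B = forces K k e' B"
    by (auto intro!: Disj.IH Disj.prems)
  then show ?case by simp
next
  case (Neg A)
  have "forces K k' e A = forces K k' e' A" for k'
    by (auto intro!: Neg.IH Neg.prems)
  then show ?case by simp
next
  case (Imp A B)
  have "forces K k' e A = forces K k' e' A" "forces K k' e B = forces K k' e' B" for k'
    by (auto intro!: Imp.IH Imp.prems)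
  then show ?case by simp
next
  case (All x A)
  have "forces K k' (e(x := d)) A = forces K k' (e'(x := d)) A" for k' d
    by (rule All.IH) (auto simp: All.prems)
  then show ?case by simp
next
  case (Ex x A)
  have "forces K k' (e(x := d)) A = forces K k' (e'(x := d)) A" for k' d
    by (rule Ex.IH) (auto simp: Ex.prems)
  then show ?case by simp
qed simp_all

lemma subst_not_free: "x \<notin> FV A \<Longrightarrow> subst A x a = A"
  by (induction A) (auto intro: map_idI)

lemma forces_subst:
  assumes "free_for a x A"
  shows "forces K k e (subst A x a) \<longleftrightarrow> forces K k (e(x := e a)) A"
  using assms
proof (induction A arbitrary: k e)
  case (Atom P ys)
  have "map e (map (\<lambda>y. if y = x then a else y) ys) = map (e(x := e a)) ys" by simp
  then show ?case by (simp only: subst.simps forces.simps)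
next
  case (All y A)
  show ?case
  proof (cases "x \<in> FV (All y A)")
    case False
    then show ?thesis
      by (subst subst_not_free) (auto intro!: forces_cong simp del: forces.simps)
  next
    case True
    with All.prems have y: "y \<noteq> a" "free_for a x A" "y \<noteq> x" by auto
    have "forces K k' (e(y := d)) (subst A x a) \<longleftrightarrow> forces K k' (e(x := e a, y := d)) A" for k' d
    proof -
      have "(e(y := d))(x := (e(y := d)) a) = e(x := e a, y := d)" using y by auto
      with All.IH[OF y(2), of k' "e(y := d)"] show ?thesis by (simp only:)
    qed
    then show ?thesis using y(3) by (simp del: fun_upd_apply)
  qed
next
  case (Ex y A)
  show ?case
  proof (cases "x \<in> FV (Ex y A)")
    case False
    then show ?thesis
      by (subst subst_not_free) (auto intro!: forces_cong simp del: forces.simps)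
  next
    case True
    with Ex.prems have y: "y \<noteq> a" "free_for a x A" "y \<noteq> x" by auto
    have "forces K k' (e(y := d)) (subst A x a) \<longleftrightarrow> forces K k' (e(x := e a, y := d)) A" for k' d
    proof -
      have "(e(y := d))(x := (e(y := d)) a) = e(x := e a, y := d)" using y by auto
      with Ex.IH[OF y(2), of k' "e(y := d)"] show ?thesis by (simp only:)
    qed
    then show ?thesis using y(3) by (simp del: fun_upd_apply)
  qed
qed simp_all

lemma forces_subst_eigenvariable:
  assumes "free_for a x F" and "a \<notin> FV F - {x}"
  shows "forces K k (e(a := d)) (subst F x a) \<longleftrightarrow> forces K k (e(x := d)) F"
  unfolding forces_subst[OF assms(1)]
  by (rule forces_cong) (use assms(2) in auto)

section \<open>Persistence and propositional formulas\<close>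

text \<open>
  Since vacuous quantification is excluded, a quantified propositional formula is impossible, which
  disposes of the quantifier cases in \<open>propositional_stable\<close>.
\<close>

lemma propositional_FV: "propositional L A \<Longrightarrow> FV A = {}"
  by (induction A) (auto simp: propositional_def)

context
  fixes L :: "'p lang" and K :: "('p, 'n, 'd) kripke"
  assumes K: "kripke_structure L K"
begin

lemma Le_refl: "k \<in> Nodes K \<Longrightarrow> (k, k) \<in> Le K"
  using K by (auto simp: kripke_structure_def partial_order_on_def preorder_on_def refl_on_def)

lemma Le_trans: "(k, k') \<in> Le K \<Longrightarrow> (k', k'') \<in> Le K \<Longrightarrow> (k, k'') \<in> Le K"
  using K by (auto simp: kripke_structure_def partial_order_on_def preorder_on_def dest: transD)

lemma Le_Nodes: "(k, k') \<in> Le K \<Longrightarrow> k \<in> Nodes K" "(k, k') \<in> Le K \<Longrightarrow> k' \<in> Nodes K"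
  using K by (auto simp: kripke_structure_def partial_order_on_def preorder_on_def refl_on_def)

lemma Dom_mono: "(k, k') \<in> Le K \<Longrightarrow> Dom K k \<subseteq> Dom K k'"
  using K by (auto simp: kripke_structure_def)

lemma forces_mono: "(k, k') \<in> Le K \<Longrightarrow> forces K k e A \<Longrightarrow> forces K k' e A"
proof (induction A arbitrary: e)
  case (Atom P xs)
  then show ?case using K by (auto simp: kripke_structure_def)
next
  case (Ex x A)
  then show ?case using Dom_mono by (auto; blast)
qed (auto intro: Le_trans)

lemma propositional_stable:
  assumes "constrained L K" and "propositional L A" and "(k, k') \<in> Le K"
  shows "forces K k' e A \<longleftrightarrow> forces K k e A"
  using assms(2,3)
proof (induction A arbitrary: k k')
  case (Atom P xs)
  then have "xs = []" "L P = Some 0" by (auto simp: propositional_def)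
  then show ?case using assms(1) Atom.prems(2) by (auto simp: constrained_def)
next
  case (Neg A)
  then have "propositional L A" by (simp add: propositional_def)
  \<comment> \<open>By the induction hypothesis, the condition on all later nodes holds iff it holds at
    the node itself, which is among them by reflexivity.\<close>
  with Neg.IH Neg.prems(2) show ?case
    by simp (meson Le_Nodes Le_refl)
next
  case (Imp A B)
  then have "propositional L A" "propositional L B" by (auto simp: propositional_def)
  with Imp.IH Imp.prems(2) show ?case
    by simp (meson Le_Nodes Le_refl)
next
  case (All x A)
  then have "propositional L A" "x \<in> FV A" by (auto simp: propositional_def)
  then show ?case using propositional_FV by fastforce
next
  case (Ex x A)
  then have "propositional L A" "x \<in> FV A" by (auto simp: propositional_def)
  then show ?case using propositional_FV by fastforce
qed (auto simp: propositional_def)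

section \<open>Soundness\<close>

text \<open>
  The node and the assignment have to vary in the induction: the right rules for \<open>\<not>\<close>,
  \<open>\<supset>\<close> and \<open>\<forall>\<close> use the hypothesis at later nodes, to which
  forcing of the antecedent persists, and the eigenvariable rules use it for an assignment changed at
  the eigenvariable.
\<close>

lemma soundness_total:
  assumes "constrained L K" and "LJ_plus L \<Gamma> \<Lambda>"
    and "k \<in> Nodes K" and "range e \<subseteq> Dom K k" and "\<And>A. A \<in> set \<Gamma> \<Longrightarrow> forces K k e A"
  shows "\<exists>B. \<Lambda> = Some B \<and> forces K k e B"
  using assms(2-)
proof (induction arbitrary: k e rule: LJ_plus.induct)
  case (Cut \<Gamma> C \<Pi> \<Lambda>)
  have "forces K k e C" using Cut.IH(1)[OF Cut.prems(1,2)] Cut.prems(3) by auto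
  then show ?case by (intro Cut.IH(2)) (use Cut.prems in auto)
next
  case (DisjL A \<Gamma> \<Lambda> B)
  have "forces K k e (Disj A B)" by (rule DisjL.prems) simp
  then consider "forces K k e A" | "forces K k e B" by auto
  then show ?case
  proof cases
    case 1
    then show ?thesis by (intro DisjL.IH(1)) (use DisjL.prems in auto)
  next
    case 2
    then show ?thesis by (intro DisjL.IH(2)) (use DisjL.prems in auto)
  qed
next
  case (ConjL1 A \<Gamma> \<Lambda> B)
  have "forces K k e (Conj A B)" by (rule ConjL1.prems) simp
  then show ?case by (intro ConjL1.IH) (use ConjL1.prems in auto)
next
  case (ConjL2 B \<Gamma> \<Lambda> A)
  have "forces K k e (Conj A B)" by (rule ConjL2.prems) simp
  then show ?case by (intro ConjL2.IH) (use ConjL2.prems in auto)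
next
  case (NegR A \<Gamma>)
  have "\<not> forces K k' e A" if k': "(k, k') \<in> Le K" for k'
  proof
    assume "forces K k' e A"
    then have "\<exists>B. None = Some B \<and> forces K k' e B"
      by (intro NegR.IH) (use NegR.prems Dom_mono[OF k'] Le_Nodes[OF k'] forces_mono[OF k'] in auto)
    then show False by simp
  qed
  then show ?case by simp
next
  case (NegL \<Gamma> A)
  have "forces K k e (Neg A)" by (rule NegL.prems) simp
  then have "\<not> forces K k e A" using Le_refl[OF NegL.prems(1)] by simp
  moreover have "forces K k e A" using NegL.IH[OF NegL.prems(1,2)] NegL.prems(3) by auto
  ultimately show ?case by simp
next
  case (ImpR A \<Gamma> B)
  have "forces K k' e B" if k': "(k, k') \<in> Le K" and "forces K k' e A" for k'
  proof -
    have "\<exists>C. Some B = Some C \<and> forces K k' e C"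
      by (intro ImpR.IH)
        (use ImpR.prems Dom_mono[OF k'] Le_Nodes[OF k'] forces_mono[OF k'] that(2) in auto)
    then show ?thesis by simp
  qed
  then show ?case by simp
next
  case (ImpL \<Gamma> A B \<Pi> \<Lambda>)
  have "forces K k e (Imp A B)" by (rule ImpL.prems) simp
  moreover have "forces K k e A" using ImpL.IH(1)[OF ImpL.prems(1,2)] ImpL.prems(3) by auto
  ultimately have "forces K k e B" using Le_refl[OF ImpL.prems(1)] by simp
  then show ?case by (intro ImpL.IH(2)) (use ImpL.prems in auto)
next
  case (AllR \<Gamma> F x a)
  have "forces K k' (e(x := d)) F" if k': "(k, k') \<in> Le K" and d: "d \<in> Dom K k'" for k' d
  proof -
    have "forces K k' (e(a := d)) A" if "A \<in> set \<Gamma>" for A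
    proof -
      have "a \<notin> FV A" using AllR.hyps that by (auto simp: FV_seq_def)
      then have "forces K k' (e(a := d)) A = forces K k' e A" by (intro forces_cong) auto
      then show ?thesis using forces_mono[OF k'] AllR.prems(3) that by simp
    qed
    moreover have "range (e(a := d)) \<subseteq> Dom K k'"
      using AllR.prems(2) Dom_mono[OF k'] d by auto
    ultimately have "\<exists>B. Some (subst F x a) = Some B \<and> forces K k' (e(a := d)) B"
      by (intro AllR.IH[OF Le_Nodes(2)[OF k']])
    moreover have "a \<notin> FV F - {x}" using AllR.hyps by (auto simp: FV_seq_def)
    ultimately show ?thesis
      using forces_subst_eigenvariable[OF AllR.hyps(3), of K k' e d] by simp
  qed
  then show ?case by simp
next
  case (AllL F x a \<Gamma> \<Lambda>)
  have "forces K k e (All x F)" by (rule AllL.prems) simp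
  moreover have "e a \<in> Dom K k" using AllL.prems(2) by auto
  ultimately have "forces K k (e(x := e a)) F" using Le_refl[OF AllL.prems(1)] by simp
  then have "forces K k e (subst F x a)" by (simp only: forces_subst[OF AllL.hyps(3)])
  then show ?case by (intro AllL.IH) (use AllL.prems in auto)
next
  case (ExR \<Gamma> F x a)
  then have "forces K k e (subst F x a)" by auto
  then have "forces K k (e(x := e a)) F" by (simp only: forces_subst[OF ExR.hyps(3)])
  then show ?case using ExR.prems(2) by auto
next
  case (ExL F x a \<Gamma> \<Lambda>)
  have "forces K k e (Ex x F)" by (rule ExL.prems) simp
  then obtain d where d: "d \<in> Dom K k" "forces K k (e(x := d)) F" by auto
  have "a \<notin> FV F - {x}" using ExL.hyps by (auto simp: FV_seq_def)
  then have F: "forces K k (e(a := d)) (subst F x a)"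
    using d(2) forces_subst_eigenvariable[OF ExL.hyps(3), of K k e d] by simp
  have irrelevant: "forces K k (e(a := d)) A = forces K k e A"
    if "A \<in> set \<Gamma> \<union> set_option \<Lambda>" for A
    using ExL.hyps that by (intro forces_cong) (auto simp: FV_seq_def)
  have "forces K k (e(a := d)) A" if "A \<in> set (subst F x a # \<Gamma>)" for A
    using that F irrelevant[of A] ExL.prems(3)[of A] by auto
  moreover have "range (e(a := d)) \<subseteq> Dom K k" using ExL.prems(2) d(1) by auto
  ultimately have "\<exists>B. \<Lambda> = Some B \<and> forces K k (e(a := d)) B"
    by (intro ExL.IH[OF ExL.prems(1)])
  then show ?case using irrelevant by auto
next
  case (Neutralization N \<Gamma> \<Lambda>)
  show ?case
  proof (cases "forces K k e N")
    case True
    then show ?thesis by (intro Neutralization.IH(1)) (use Neutralization.prems in auto)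
  next
    case False
    then have "forces K k e (Neg N)"
      using propositional_stable[OF assms(1) Neutralization.hyps(3)] by simp
    then show ?thesis by (intro Neutralization.IH(2)) (use Neutralization.prems in auto)
  qed
next
  case (Exch \<Pi> A B \<Gamma> \<Lambda>)
  then show ?case by (intro Exch.IH) auto
next
  case (ThinL \<Gamma> \<Lambda> A)
  then show ?case by (intro ThinL.IH) auto
next
  case (ThinR \<Gamma> A)
  then have "\<exists>B. None = Some B \<and> forces K k e B" by (intro ThinR.IH) auto
  then show ?case by simp
next
  case (Contr A \<Gamma> \<Lambda>)
  then show ?case by (intro Contr.IH) auto
next
  case (ConjR \<Gamma> A B)
  have "forces K k e A" using ConjR.IH(1)[OF ConjR.prems] by simp
  moreover have "forces K k e B" using ConjR.IH(2)[OF ConjR.prems] by simp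
  ultimately show ?case by simp
next
  case (DisjR1 \<Gamma> A B)
  show ?case using DisjR1.IH[OF DisjR1.prems] by simp
next
  case (DisjR2 \<Gamma> B A)
  show ?case using DisjR2.IH[OF DisjR2.prems] by simp
qed auto

end

theorem mainTheorem6:
  fixes L :: "'p lang" and \<Gamma> :: "'p fm list" and \<Lambda> :: "'p fm option"
  assumes "LJ_plus L \<Gamma> \<Lambda>"
  shows "valid TYPE('n \<times> 'd) L \<Gamma> \<Lambda>"
  unfolding valid_def
proof (intro allI impI)
  fix K :: "('p, 'n, 'd) kripke" and k e
  assume K: "kripke_structure L K" "constrained L K" and k: "k \<in> Nodes K"
    and e: "\<forall>x \<in> FV_seq \<Gamma> \<Lambda>. e x \<in> Dom K k"
  obtain d where d: "d \<in> Dom K k" using K(1) k unfolding kripke_structure_def by blast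
  define e' where "e' x = (if x \<in> FV_seq \<Gamma> \<Lambda> then e x else d)" for x
  have eq: "forces K k e' A = forces K k e A" if "A \<in> set \<Gamma> \<union> set_option \<Lambda>" for A
    using that by (intro forces_cong) (auto simp: e'_def FV_seq_def)
  have "range e' \<subseteq> Dom K k" using d e by (auto simp: e'_def)
  with soundness_total[OF K(1,2) assms k] eq
  show "(\<exists>A \<in> set \<Gamma>. \<not> forces K k e A) \<or> (\<exists>B. \<Lambda> = Some B \<and> forces K k e B)"
    by (metis UnI1 UnI2 option.set_intros)
qed

end
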